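(* For each integer $t\ge 1$ define $$f_t(s)=\sum_{m=1}^t L(t,m)\,(s+1)^{\overline{m-1}}.$$ Then, for every $t\ge1$, $f_t(s)$ is a monic polynomial in $s$ of degree $t-1$ with non-negative integer coefficients; its constant term is $(2^t-1)(t-1)!$; and for every integer $s\ge 1$ coprime to $t$, the number of $(s,s+t,s+2t,\dots)$-core partitions (of all sizes) is $$\frac{2^{s-t}f_t(s)}{t!}.$$
   Context: The $L(t,m)$ are the unsigned Lah numbers, defined for $t\ge m\ge 1$ by $L(t,m)=\frac{t!}{m!}\binom{t-1}{m-1}$. Rising factorials: $x^{\overline{0}}=1$ and $x^{\overline{m}}=x(x+1)(x+2)\cdots(x+m-1)$ for $m\ge1$. The hooklength of a box in the Young diagram of a partition is the number of boxes directly to its right plus the number of boxes directly below it plus $1$. An $(s,s+t,s+2t,\dots)$-core is a partition (the empty partition included) having no hook whose length lies in the infinite set $\{s,s+t,s+2t,s+3t,\dots\}$. *)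

theory Defs
  imports Complex_Main "HOL-Computational_Algebra.Polynomial"
begin

text \<open>Unsigned Lah numbers, meant for \<open>1 \<le> m \<le> t\<close>, so that no subtraction truncates.\<close>

definition lah :: "nat \<Rightarrow> nat \<Rightarrow> real" where
  "lah t m = fact t / fact m * real ((t - 1) choose (m - 1))"

text \<open>\<^const>\<open>pochhammer\<close> is the rising factorial.\<close>

definition core_fun :: "nat \<Rightarrow> real \<Rightarrow> real" where
  "core_fun t x = (\<Sum>m=1..t. lah t m * pochhammer (x + 1) (m - 1))"

text \<open>A partition is the weakly decreasing list of its (positive) parts, so that distinct lists are
  distinct partitions and the empty list is the empty partition. A box is a pair (row, column),
  both counted from 0.\<close>

definition is_partition :: "nat list \<Rightarrow> bool" where
  "is_partition ps \<longleftrightarrow> sorted_wrt (\<ge>) ps \<and> (\<forall>p\<in>set ps. p \<ge> 1)"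

definition young_diagram :: "nat list \<Rightarrow> (nat \<times> nat) set" where
  "young_diagram ps = {(i, j). i < length ps \<and> j < ps ! i}"

definition hook_length :: "nat list \<Rightarrow> nat \<Rightarrow> nat \<Rightarrow> nat" where
  "hook_length ps i j =
     card {j'. j < j' \<and> (i, j') \<in> young_diagram ps}
     + card {i'. i < i' \<and> (i', j) \<in> young_diagram ps} + 1"

definition is_core :: "nat set \<Rightarrow> nat list \<Rightarrow> bool" where
  "is_core H ps \<longleftrightarrow>
     is_partition ps \<and> (\<forall>(i, j)\<in>young_diagram ps. hook_length ps i j \<notin> H)"

definition ap_cores :: "nat \<Rightarrow> nat \<Rightarrow> nat list set" where
  "ap_cores s t = {ps. is_core {s + k * t | k. True} ps}"

end

theory Submission
  imports Defs "HOL-Number_Theory.Cong" "HOL-Computational_Algebra.Formal_Power_Series"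
begin

text \<open>The beta set (Maya diagram) turns a core into a set \<open>B\<close> of integers, determined up to
  translation, with \<open>B - s - k t \<subseteq> B\<close> for all \<open>k \<ge> 0\<close>. The group \<open>\<int> / t\<int>\<close> acts freely on such sets modulo
  translation by \<open>t\<close>, so the number of cores is \<open>1 / t\<close> times the number of \<open>B\<close> whose residue
  class of 0 has greatest element 0. Visiting the residue classes in the order \<open>-s, -2 s, ..., -t s\<close>,
  which exhausts them because \<open>s\<close> and \<open>t\<close> are coprime, the rescaled maxima form a chain
  \<open>0 = a\<^sub>0 \<le> a\<^sub>1 \<le> ... \<le> a\<^sub>t = s\<close>, and the elements of \<open>B\<close> strictly between \<open>a\<^sub>k\<close> and \<open>a\<^sub>k\<^sub>+\<^sub>1\<close> in the
  next class are arbitrary. Hence the count is the coefficient of \<open>x\<^sup>s\<close> in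
  \<open>((1 - x) / (1 - 2 x))\<^sup>t = 2\<^sup>-\<^sup>t (1 + 1 / (1 - 2 x))\<^sup>t\<close>, which the binomial theorem expands into
  the Lah number formula.\<close>

subsection \<open>Shift classes of down-closed sets\<close>

lemma ex_greatest_int:
  fixes A :: "int set"
  assumes "a \<in> A" "\<forall>x\<in>A. x \<le> u"
  shows "\<exists>m\<in>A. \<forall>x\<in>A. x \<le> m"
proof -
  let ?F = "A \<inter> {a..u}"
  have fin: "finite ?F" by simp
  have "a \<in> ?F" using assms by auto
  then have "Max ?F \<in> ?F" using Max_in[OF fin] by blast
  moreover have "x \<le> Max ?F" if "x \<in> A" for x
  proof (cases "a \<le> x")
    case True
    then show ?thesis using that assms(2) Max_ge[OF fin, of x] by auto
  next
    case False
    then show ?thesis using Max_ge[OF fin \<open>a \<in> ?F\<close>] by linarith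
  qed
  ultimately show ?thesis by blast
qed

lemma ex_least_int:
  fixes A :: "int set"
  assumes "a \<in> A" "\<forall>x\<in>A. u \<le> x"
  shows "\<exists>m\<in>A. \<forall>x\<in>A. m \<le> x"
  using ex_greatest_int[of "- a" "uminus ` A" "- u"] assms by auto

text \<open>As \<open>s\<close> is invertible modulo \<open>t\<close>, its multiples meet every
  residue class once. Counting \<open>k\<close> from 1 guarantees at least one step by
  \<open>s\<close>; the class of 0 gets \<open>k = t\<close>.\<close>

lemma coprime_residue_ex1:
  fixes s t :: nat and x :: int
  assumes "coprime s t" "t \<ge> 1"
  shows "\<exists>!k::nat. k \<in> {1..t} \<and> int t dvd x + int k * int s"
proof -
  obtain r where r: "[int s * r = 1] (mod int t)"
    using cong_solve_coprime_int[of "int s" "int t"] assms by auto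
  let ?l = "nat ((- x * r) mod int t)"
  let ?k = "if ?l = 0 then t else ?l"
  have l: "int ?l = (- x * r) mod int t" using assms by (intro nat_0_le pos_mod_sign) simp
  have "int ?l < int t" unfolding l using assms by (intro pos_mod_bound) simp
  then have "?l < t" by linarith
  then have mem: "?k \<in> {1..t}" using assms by auto
  have "[int ?k = - x * r] (mod int t)"
  proof (cases "?l = 0")
    case True
    then have "(- x * r) mod int t = 0" using l by linarith
    then show ?thesis using True by (simp add: cong_def)
  next
    case False
    then show ?thesis using l by (simp add: cong_def)
  qed
  then have "[x + int ?k * int s = x + (- x * r) * int s] (mod int t)"
    by (intro cong_add cong_mult cong_refl)
  also have "x + (- x * r) * int s = x + (- x) * (int s * r)" by simp
  also have "[x + (- x) * (int s * r) = x + (- x) * 1] (mod int t)"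
    by (intro cong_add cong_mult cong_refl r)
  finally have "int t dvd x + int ?k * int s" by (simp add: cong_0_iff)
  moreover have "k = l"
    if "k \<in> {1..t}" "int t dvd x + int k * int s" "l \<in> {1..t}" "int t dvd x + int l * int s" for k l
  proof -
    have "int t dvd (x + int k * int s) - (x + int l * int s)" using that by (intro dvd_diff)
    then have "int t dvd (int k - int l) * int s" by (simp add: algebra_simps)
    then have "int t dvd int k - int l"
      using assms coprime_commute coprime_dvd_mult_left_iff by (metis coprime_int_iff)
    moreover have "\<bar>int k - int l\<bar> < int t" using that by auto
    ultimately show ?thesis
      using dvd_imp_le_int[of "int k - int l" "int t"] by (cases "int k - int l = 0") auto
  qed
  ultimately show ?thesis using mem by blast
qed

text \<open>A multiple of \<open>t\<close> may be subtracted only together with an \<open>s\<close>;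
  \<open>x - t\<close> need not belong to \<open>B\<close>.\<close>

definition down_closed :: "nat \<Rightarrow> nat \<Rightarrow> int set \<Rightarrow> bool" where
  "down_closed s t B \<longleftrightarrow> (\<forall>x\<in>B. \<forall>k::nat. x - int s - int k * int t \<in> B)"

lemma down_closedD: "down_closed s t B \<Longrightarrow> x \<in> B \<Longrightarrow> x - int s - int k * int t \<in> B"
  by (auto simp: down_closed_def)

text \<open>Subtract \<open>s\<close> alone in all steps but the last, and the whole multiple of
  \<open>t\<close> in the last one, which exists because \<open>k\<close> is positive.\<close>

lemma down_closed_iterate:
  assumes "down_closed s t B" "x \<in> B" "k \<ge> 1"
  shows "x - int k * int s - int n * int t \<in> B"
  using assms(3)
proof (induction k arbitrary: n rule: nat_induct_at_least)
  case base
  then show ?case using down_closedD[OF assms(1,2), of n] by simp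
next
  case (Suc k)
  have "x - int k * int s \<in> B" using Suc(2)[of 0] by simp
  from down_closedD[OF assms(1) this, of n] show ?case by (simp add: algebra_simps)
qed

lemma down_closed_shift: "down_closed s t B \<Longrightarrow> down_closed s t {x. x + c \<in> B}"
  unfolding down_closed_def by (auto simp: algebra_simps)

text \<open>Up to translation, a core is a down-closed set of integers that is neither empty nor
  everything. The two normalisations below pin the translation by the least gap, respectively by
  the greatest element of the residue class of 0.\<close>

definition gap_normal :: "nat \<Rightarrow> nat \<Rightarrow> int set set" where
  "gap_normal s t = {B. down_closed s t B \<and> {..<0} \<subseteq> B \<and> 0 \<notin> B}"

definition top_normal :: "nat \<Rightarrow> nat \<Rightarrow> int set set" where
  "top_normal s t = {B. down_closed s t B \<and> 0 \<in> B \<and> (\<forall>n>0. int t * n \<notin> B)}"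

text \<open>Otherwise some \<open>x - k s\<close> with \<open>k\<close> in \<open>{1..t}\<close> is
  divisible by \<open>t\<close>, and it is nonnegative since \<open>k s <= t s\<close>; descending
  from \<open>x\<close> then reaches the gap 0.\<close>

lemma gap_normal_less:
  assumes "coprime s t" "t \<ge> 1" "B \<in> gap_normal s t" "x \<in> B"
  shows "x < int t * int s"
proof (rule ccontr)
  assume neg: "\<not> x < int t * int s"
  obtain k where k: "k \<in> {1..t}" "int t dvd - x + int k * int s"
    using coprime_residue_ex1[OF assms(1,2)] by blast
  then have "int t dvd x - int k * int s" by (metis dvd_minus_iff minus_diff_eq uminus_add_conv_diff)
  then obtain n where n: "x - int k * int s = int t * n" by blast
  have "int k * int s \<le> int t * int s" using k by (intro mult_right_mono) auto
  then have "int t * n \<ge> 0" using n neg by linarith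
  then have "n \<ge> 0" using assms(2) by (simp add: zero_le_mult_iff)
  then have "x - int k * int s - int (nat n) * int t = 0" using n by simp
  moreover have "x - int k * int s - int (nat n) * int t \<in> B"
    using assms k by (intro down_closed_iterate) (auto simp: gap_normal_def)
  ultimately show False using assms(3) by (simp add: gap_normal_def)
qed

text \<open>The mirror image of the preceding bound: such an \<open>x\<close> is reached by
  descending from 0.\<close>

lemma top_normal_contains:
  assumes "coprime s t" "t \<ge> 1" "B \<in> top_normal s t" "x \<le> - (int t * int s)"
  shows "x \<in> B"
proof -
  obtain k where k: "k \<in> {1..t}" "int t dvd x + int k * int s"
    using coprime_residue_ex1[OF assms(1,2)] by blast
  then obtain n where n: "x + int k * int s = int t * n" by blast
  have "int k * int s \<le> int t * int s" using k by (intro mult_right_mono) auto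
  then have "int t * n \<le> 0" using n assms(4) by linarith
  then have "n \<le> 0" using assms(2) by (simp add: mult_le_0_iff)
  then have "0 - int k * int s - int (nat (- n)) * int t = x" using n by (simp add: algebra_simps)
  moreover have "0 - int k * int s - int (nat (- n)) * int t \<in> B"
    using assms k by (intro down_closed_iterate) (auto simp: top_normal_def)
  ultimately show ?thesis by metis
qed

text \<open>The bijection shifts \<open>B\<close> so that the greatest element of its class
  \<open>i\<close> moves to 0. Backwards, the least gap \<open>g\<close> is moved to 0, and
  \<open>i\<close> is the residue of \<open>- g\<close>, the new place of the old 0.\<close>

lemma bij_betw_gap_normal_top_normal:
  assumes "coprime s t" "t \<ge> 1"
  shows "\<exists>f. bij_betw f ({0..<int t} \<times> gap_normal s t) (top_normal s t)"
proof -
  define top where "top i B = (THE m. m \<in> B \<and> m mod int t = i \<and> (\<forall>x\<in>B. x mod int t = i \<longrightarrow> x \<le> m))"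
    for i and B :: "int set"
  have top_eq: "top i B = m" if "m \<in> B" "m mod int t = i" "\<And>x. x \<in> B \<Longrightarrow> x mod int t = i \<Longrightarrow> x \<le> m"
    for i m B
    unfolding top_def using that by (intro the_equality) (auto intro: antisym)
  have top: "top i B \<in> B \<and> top i B mod int t = i \<and> (\<forall>x\<in>B. x mod int t = i \<longrightarrow> x \<le> top i B)"
    if i: "i \<in> {0..<int t}" and B: "B \<in> gap_normal s t" for i B
  proof -
    let ?A = "{x \<in> B. x mod int t = i}"
    have "i - int t \<in> B" using i B by (auto simp: gap_normal_def)
    then have "i - int t \<in> ?A" using i by simp
    moreover have "\<forall>x\<in>?A. x \<le> int t * int s"
      using gap_normal_less[OF assms B] by fastforce
    ultimately have "\<exists>m\<in>?A. \<forall>x\<in>?A. x \<le> m" by (rule ex_greatest_int)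
    then obtain m where "m \<in> ?A" "\<forall>x\<in>?A. x \<le> m" by blast
    then show ?thesis using top_eq[of m B i] by auto
  qed
  define f where "f = (\<lambda>(i, B). {x. x + top i B \<in> B})"
  have "inj_on f ({0..<int t} \<times> gap_normal s t)"
  proof (rule inj_onI, clarify)
    fix i B j C
    assume i: "i \<in> {0..<int t}" and B: "B \<in> gap_normal s t" and j: "j \<in> {0..<int t}"
      and C: "C \<in> gap_normal s t" and eq: "f (i, B) = f (j, C)"
    have eq: "x + top i B \<in> B \<longleftrightarrow> x + top j C \<in> C" for x using eq by (auto simp: f_def)
    \<comment> \<open>The least gap of \<open>f (i, B)\<close> is \<open>- top i B\<close>, so equal
      images have equal tops.\<close>
    have "top j C \<ge> top i B"
      using eq[of "- top i B"] B C by (force simp: gap_normal_def)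
    moreover have "top i B \<ge> top j C"
      using eq[of "- top j C"] B C by (force simp: gap_normal_def)
    ultimately have teq: "top i B = top j C" by simp
    then have "i = j" using top[OF i B] top[OF j C] by auto
    moreover have "B = C"
    proof (rule set_eqI)
      fix x show "x \<in> B \<longleftrightarrow> x \<in> C" using eq[of "x - top i B"] teq by simp
    qed
    ultimately show "i = j \<and> B = C" by simp
  qed
  moreover have "f ` ({0..<int t} \<times> gap_normal s t) = top_normal s t"
  proof (intro equalityI subsetI)
    fix D assume "D \<in> f ` ({0..<int t} \<times> gap_normal s t)"
    then obtain i B where i: "i \<in> {0..<int t}" and B: "B \<in> gap_normal s t"
      and D: "D = {x. x + top i B \<in> B}" by (auto simp: f_def)
    have "int t * n + top i B \<notin> B" if "n > 0" for n
    proof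
      assume "int t * n + top i B \<in> B"
      moreover have "(int t * n + top i B) mod int t = i" using top[OF i B] by simp
      ultimately have "int t * n \<le> 0" using top[OF i B] by fastforce
      then show False using that assms(2) by (simp add: mult_le_0_iff)
    qed
    then show "D \<in> top_normal s t"
      using B top[OF i B] down_closed_shift unfolding D top_normal_def gap_normal_def by auto
  next
    fix D assume D: "D \<in> top_normal s t"
    have "int t \<in> - D" using D by (auto simp: top_normal_def dest: spec[of _ 1])
    moreover have "\<forall>x\<in>- D. - (int t * int s) \<le> x"
      using top_normal_contains[OF assms D] by (metis Compl_iff linear)
    ultimately have "\<exists>g\<in>- D. \<forall>x\<in>- D. g \<le> x" by (rule ex_least_int)
    then obtain g where g: "g \<notin> D" "\<And>x. x \<notin> D \<Longrightarrow> g \<le> x" by blast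
    define B where "B = {x. x + g \<in> D}"
    have B: "B \<in> gap_normal s t"
      using D g down_closed_shift unfolding B_def top_normal_def gap_normal_def by fastforce
    let ?i = "(- g) mod int t"
    have "top ?i B = - g"
    proof (rule top_eq)
      show "- g \<in> B" using D by (simp add: B_def top_normal_def)
      fix x assume x: "x \<in> B" "x mod int t = - g mod int t"
      then obtain n where "x + g = int t * n"
        by (metis mod_eq_dvd_iff diff_minus_eq_add dvdE)
      then have "\<not> n > 0" using x D by (auto simp: B_def top_normal_def)
      then have "x + g \<le> 0" using \<open>x + g = int t * n\<close> by (simp add: mult_le_0_iff)
      then show "x \<le> - g" by simp
    qed simp
    then have "f (?i, B) = D" by (simp add: f_def B_def)
    then show "D \<in> f ` ({0..<int t} \<times> gap_normal s t)"
      using B assms(2) by (intro image_eqI[of _ _ "(?i, B)"]) auto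
  qed
  ultimately show ?thesis unfolding bij_betw_def by blast
qed

subsection \<open>Counting chains\<close>

text \<open>A set \<open>B\<close> in \<^term>\<open>top_normal s t\<close> is recorded by the sets \<open>N k = {n. t n - k s \<in> B}\<close> for
  \<open>1 \<le> k \<le> t\<close>, which cover every integer exactly once. The sentinels \<open>N 0 = {..0}\<close> and
  \<open>N k = {}\<close> for \<open>k > t\<close> only make \<open>N\<close> unique.\<close>

definition core_chains :: "nat \<Rightarrow> nat \<Rightarrow> (nat \<Rightarrow> int set) set" where
  "core_chains t s = {N. N 0 = {..0} \<and> (\<forall>k<t. \<forall>x\<in>N k. {..x} \<subseteq> N (Suc k)) \<and>
     N t \<subseteq> {..int s} \<and> int s \<in> N t \<and> (\<forall>k>t. N k = {})}"

lemma core_chains_contains: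
  assumes "N \<in> core_chains t s" "k \<le> t"
  shows "{..0} \<subseteq> N k"
  using assms(2)
proof (induction k)
  case 0
  then show ?case using assms by (simp add: core_chains_def)
next
  case (Suc k)
  then have "0 \<in> N k" by auto
  then show ?case using Suc.prems assms(1) by (simp add: core_chains_def)
qed

lemma core_chains_le:
  assumes "N \<in> core_chains t s" "k \<le> t" "x \<in> N k"
  shows "x \<le> int s"
  using assms(2,3)
proof (induction k rule: inc_induct)
  case base
  then show ?case using assms(1) by (auto simp: core_chains_def)
next
  case (step k)
  then show ?case using assms(1) by (force simp: core_chains_def)
qed

text \<open>By coprimality every integer is \<open>t n - k s\<close> for exactly one
  \<open>n\<close> and one \<open>k\<close> in \<open>{1..t}\<close>, so splitting into classes
  (\<open>F\<close>) and reassembling (\<open>G\<close>) are inverse. A step by \<open>s\<close>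
  leads from class \<open>k\<close> to class \<open>k + 1\<close>, which turns closure into the
  chain condition.\<close>

lemma bij_betw_top_normal_core_chains:
  assumes "coprime s t" "t \<ge> 1"
  shows "\<exists>f. bij_betw f (top_normal s t) (core_chains t s)"
proof -
  define F where "F B k = (if k = 0 then {..0} else if k \<le> t then {n. int t * n - int k * int s \<in> B} else {})"
    for B and k :: nat
  define G where "G N = {x. \<exists>k\<in>{1..t}. \<exists>n\<in>N k. x = int t * n - int k * int s}" for N :: "nat \<Rightarrow> int set"
  have ex: "\<exists>k\<in>{1..t}. \<exists>n. x = int t * n - int k * int s" for x
  proof -
    obtain k n where "k \<in> {1..t}" "x + int k * int s = int t * n"
      using coprime_residue_ex1[OF assms, of x] by (meson dvdE)
    then show ?thesis by (metis add_diff_cancel_right')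
  qed
  have uniq: "k = l \<and> n = m"
    if "k \<in> {1..t}" "l \<in> {1..t}" "int t * n - int k * int s = int t * m - int l * int s" for k l n m
  proof -
    let ?x = "int t * n - int k * int s"
    have "int t dvd ?x + int k * int s" "int t dvd ?x + int l * int s"
      by (simp, simp add: that(3))
    then have "k = l" using coprime_residue_ex1[OF assms, of ?x] that by blast
    then show ?thesis using that assms by simp
  qed
  have GI: "int t * n - int k * int s \<in> G N \<longleftrightarrow> n \<in> N k" if "k \<in> {1..t}" for k n N
  proof
    assume "int t * n - int k * int s \<in> G N"
    then obtain l m where "l \<in> {1..t}" "m \<in> N l" "int t * n - int k * int s = int t * m - int l * int s"
      by (auto simp: G_def)
    then show "n \<in> N k" using uniq[OF that] by metis
  qed (use that in \<open>auto simp: G_def\<close>)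
  have "F B \<in> core_chains t s" if B: "B \<in> top_normal s t" for B
  proof -
    have zero: "0 \<in> B" and pos: "\<And>n. n > 0 \<Longrightarrow> int t * n \<notin> B" and dc: "down_closed s t B"
      using B by (auto simp: top_normal_def)
    have "{..x} \<subseteq> F B (Suc k)" if "k < t" "x \<in> F B k" for k x
    proof
      fix y assume "y \<in> {..x}"
      show "y \<in> F B (Suc k)"
      \<comment> \<open>The sentinel at 0 stands for the element 0 of \<open>B\<close>: descending
        from it fills the first class up to index 0.\<close>
      proof (cases "k = 0")
        case True
        then have "y \<le> 0" using that \<open>y \<in> {..x}\<close> by (simp add: F_def)
        then show ?thesis using down_closedD[OF dc zero, of "nat (- y)"] that True
          by (simp add: F_def algebra_simps)
      next
        case False
        then have "int t * x - int k * int s \<in> B" using that by (simp add: F_def)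
        from down_closedD[OF dc this, of "nat (x - y)"] show ?thesis using that \<open>y \<in> {..x}\<close>
          by (simp add: F_def algebra_simps)
      qed
    qed
    \<comment> \<open>For \<open>k = t\<close> the integer \<open>t n - t s\<close> is in the class
      of 0, whose greatest element 0 therefore has index \<open>s\<close>.\<close>
    moreover have Ft: "n \<in> F B t \<longleftrightarrow> int t * (n - int s) \<in> B" for n
      using assms(2) by (simp add: F_def algebra_simps)
    have "F B t \<subseteq> {..int s}" using pos Ft by force
    moreover have "int s \<in> F B t" using zero Ft by simp
    ultimately show ?thesis by (simp add: core_chains_def F_def)
  qed
  moreover have "G N \<in> top_normal s t" if N: "N \<in> core_chains t s" for N
  proof -
    have chain: "\<And>k x y. k < t \<Longrightarrow> x \<in> N k \<Longrightarrow> y \<le> x \<Longrightarrow> y \<in> N (Suc k)"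
      and top: "int s \<in> N t" using N by (auto simp: core_chains_def)
    have "down_closed s t (G N)"
      unfolding down_closed_def
    proof (intro ballI allI)
      fix x j assume "x \<in> G N"
      then obtain k n where kn: "k \<in> {1..t}" "n \<in> N k" "x = int t * n - int k * int s" by (auto simp: G_def)
      show "x - int s - int j * int t \<in> G N"
      proof (cases "k < t")
        case True
        then have "n - int j \<in> N (Suc k)" using kn chain by simp
        moreover have "x - int s - int j * int t = int t * (n - int j) - int (Suc k) * int s"
          using kn(3) by (simp add: algebra_simps)
        ultimately show ?thesis using GI[of "Suc k" "n - int j" N] True by (simp only:) simp
      next
        \<comment> \<open>The step wraps around from class \<open>t\<close> to class 1 and lowers
          the index by a further \<open>s\<close>; as \<open>n <= s\<close>, the new index is at
          most 0.\<close>
        case False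
        then have "k = t" using kn by simp
        then have "n \<le> int s" using core_chains_le[OF N, of k n] kn by simp
        then have "n - int j - int s \<in> N (Suc 0)" using core_chains_contains[OF N, of "Suc 0"] assms by auto
        moreover have "x - int s - int j * int t = int t * (n - int j - int s) - int (Suc 0) * int s"
          using kn(3) \<open>k = t\<close> by (simp add: algebra_simps)
        ultimately show ?thesis using GI[of "Suc 0" "n - int j - int s" N] assms(2) by (simp only:) simp
      qed
    qed
    moreover have "0 \<in> G N" using GI[of t "int s" N] top assms by simp
    moreover have "int t * n \<notin> G N" if "n > 0" for n
      using GI[of t "n + int s" N] core_chains_le[OF N, of t "n + int s"] that assms
      by (auto simp: algebra_simps)
    ultimately show ?thesis by (simp add: top_normal_def)
  qed
  moreover have "G (F B) = B" for B
  proof (rule set_eqI)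
    fix x
    obtain k n where kn: "k \<in> {1..t}" "x = int t * n - int k * int s" using ex by blast
    show "x \<in> G (F B) \<longleftrightarrow> x \<in> B" using GI[OF kn(1), of n "F B"] kn by (simp add: F_def)
  qed
  moreover have "F (G N) = N" if N: "N \<in> core_chains t s" for N
  proof
    fix k
    consider "k = 0" | "k \<in> {1..t}" | "k > t" by fastforce
    then show "F (G N) k = N k"
      by cases (use N GI in \<open>auto simp: F_def core_chains_def\<close>)
  qed
  ultimately have "bij_betw F (top_normal s t) (core_chains t s)"
    by (intro bij_betw_byWitness[where f' = G]) auto
  then show ?thesis by blast
qed

text \<open>The possible sets \<open>N (t + 1)\<close> with maximum \<open>s\<close> when \<open>N t\<close> has maximum \<open>a\<close>.\<close>

definition layers :: "nat \<Rightarrow> nat \<Rightarrow> int set set" where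
  "layers a s = {X. {..int a} \<subseteq> X \<and> X \<subseteq> {..int s} \<and> int s \<in> X}"

text \<open>For \<open>a < s\<close>, the set is arbitrary on the \<open>s - a - 1\<close> integers
  strictly between \<open>a\<close> and \<open>s\<close> and fixed elsewhere.\<close>

lemma card_layers:
  assumes "a \<le> s"
  shows "finite (layers a s) \<and> card (layers a s) = (if a = s then 1 else 2 ^ (s - a - 1))"
proof (cases "a = s")
  case True
  then have "layers a s = {{..int s}}" by (auto simp: layers_def)
  then show ?thesis using True by simp
next
  case False
  then have "a < s" using assms by simp
  have "bij_betw (\<lambda>Y. insert (int s) ({..int a} \<union> Y)) (Pow {int a<..<int s}) (layers a s)"
  proof (rule bij_betw_byWitness[where f' = "\<lambda>X. X \<inter> {int a<..<int s}"])
    show "\<forall>Y\<in>Pow {int a<..<int s}. insert (int s) ({..int a} \<union> Y) \<inter> {int a<..<int s} = Y"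
      by force
    show "\<forall>X\<in>layers a s. insert (int s) ({..int a} \<union> X \<inter> {int a<..<int s}) = X"
    proof (intro ballI set_eqI)
      fix X x assume X: "X \<in> layers a s"
      then have "x \<in> X \<Longrightarrow> x \<le> int s" and "x \<le> int a \<Longrightarrow> x \<in> X" and "int s \<in> X"
        by (auto simp: layers_def)
      then show "x \<in> insert (int s) ({..int a} \<union> X \<inter> {int a<..<int s}) \<longleftrightarrow> x \<in> X"
        by (cases "x = int s"; cases "x \<le> int a") auto
    qed
    show "(\<lambda>Y. insert (int s) ({..int a} \<union> Y)) ` Pow {int a<..<int s} \<subseteq> layers a s"
      using \<open>a < s\<close> by (force simp: layers_def)
  qed auto
  moreover have "card (Pow {int a<..<int s}) = 2 ^ (s - a - 1)"
    by (simp add: card_Pow nat_diff_distrib)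
  ultimately show ?thesis using False
    by (metis bij_betw_finite bij_betw_same_card finite_Pow_iff finite_greaterThanLessThan_int)
qed

text \<open>Cut off the last set of a chain. The number \<open>a\<close> is recovered as the maximum
  of \<open>N t\<close>, and the last set can be any layer from \<open>a\<close> to
  \<open>s\<close>.\<close>

lemma bij_betw_core_chains_Suc:
  "bij_betw (\<lambda>(a, N, X). N(Suc t := X)) (SIGMA a:{..s}. core_chains t a \<times> layers a s) (core_chains (Suc t) s)"
proof (rule bij_betw_imageI)
  show "inj_on (\<lambda>(a, N, X). N(Suc t := X)) (SIGMA a:{..s}. core_chains t a \<times> layers a s)"
  proof (rule inj_onI)
    fix p q
    assume p: "p \<in> (SIGMA a:{..s}. core_chains t a \<times> layers a s)"
      and q: "q \<in> (SIGMA a:{..s}. core_chains t a \<times> layers a s)"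
      and pq: "(\<lambda>(a, N, X). N(Suc t := X)) p = (\<lambda>(a, N, X). N(Suc t := X)) q"
    obtain a N X b M Y where abs: "p = (a, N, X)" "q = (b, M, Y)" by (metis prod_cases3)
    then have N: "N \<in> core_chains t a" and M: "M \<in> core_chains t b"
      and eq: "N(Suc t := X) = M(Suc t := Y)" using p q pq by auto
    have "X = Y" using fun_cong[OF eq, of "Suc t"] by simp
    moreover have NM: "N k = M k" for k
      using fun_cong[OF eq, of k] N M by (cases "k = Suc t") (auto simp: core_chains_def)
    moreover have "a = b"
    proof -
      have "int a \<in> N t" "int b \<in> N t" "N t \<subseteq> {..int a}" "N t \<subseteq> {..int b}"
        using N M NM[of t] by (auto simp: core_chains_def)
      then show ?thesis by force
    qed
    ultimately show "p = q" using abs by auto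
  qed
  show "(\<lambda>(a, N, X). N(Suc t := X)) ` (SIGMA a:{..s}. core_chains t a \<times> layers a s) = core_chains (Suc t) s"
  proof (intro equalityI subsetI)
    fix M assume "M \<in> (\<lambda>(a, N, X). N(Suc t := X)) ` (SIGMA a:{..s}. core_chains t a \<times> layers a s)"
    then obtain a N X where "a \<le> s" and N: "N \<in> core_chains t a" and X: "X \<in> layers a s"
      and M: "M = N(Suc t := X)" by auto
    have "{..x} \<subseteq> M (Suc k)" if "k < Suc t" "x \<in> M k" for k x
    proof (cases "k = t")
      case True
      then have "x \<le> int a" using that N by (auto simp: M core_chains_def)
      then show ?thesis using X True by (auto simp: M layers_def)
    next
      case False
      then show ?thesis using that N by (simp add: M core_chains_def)
    qed
    then show "M \<in> core_chains (Suc t) s" using N X by (simp add: M core_chains_def layers_def)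
  next
    fix M assume M: "M \<in> core_chains (Suc t) s"
    have "0 \<in> M t" using core_chains_contains[OF M, of t] by auto
    moreover have "\<forall>x\<in>M t. x \<le> int s" using core_chains_le[OF M, of t] by auto
    ultimately have "\<exists>m\<in>M t. \<forall>x\<in>M t. x \<le> m" by (rule ex_greatest_int)
    then obtain m where m: "m \<in> M t" "\<forall>x\<in>M t. x \<le> m" by blast
    then have "m \<ge> 0" "m \<le> int s" using \<open>0 \<in> M t\<close> \<open>\<forall>x\<in>M t. x \<le> int s\<close> by auto
    then obtain a where a: "m = int a" "a \<le> s" by (metis of_nat_le_iff zero_le_imp_eq_int)
    \<comment> \<open>Emptying this entry restores the sentinel beyond \<open>t\<close>.\<close>
    let ?N = "M(Suc t := {})"
    have "?N \<in> core_chains t a" using M m a by (auto simp: core_chains_def)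
    moreover have "M (Suc t) \<in> layers a s" using M m a by (auto simp: core_chains_def layers_def)
    ultimately show "M \<in> (\<lambda>(a, N, X). N(Suc t := X)) ` (SIGMA a:{..s}. core_chains t a \<times> layers a s)"
      using a by (intro image_eqI[of _ _ "(a, ?N, M (Suc t))"]) auto
  qed
qed

section \<open>Generating function of the chains\<close>

definition layer_fps :: "real fps" where
  "layer_fps = Abs_fps (\<lambda>d. if d = 0 then 1 else 2 ^ (d - 1))"

text \<open>Coefficient \<open>d\<close> of \<open>layer_fps\<close> counts the layers with
  \<open>s - a = d\<close>, so appending a set convolves the counts over the maximum
  \<open>a\<close> of \<open>N t\<close>.\<close>

lemma card_core_chains: "finite (core_chains t s) \<and> real (card (core_chains t s)) = fps_nth (layer_fps ^ t) s"
proof (induction t arbitrary: s)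
  case 0
  have "core_chains 0 s = (if s = 0 then {\<lambda>k. if k = 0 then {..0} else {}} else {})"
    by (auto simp: core_chains_def fun_eq_iff)
  then show ?case by simp
next
  case (Suc t)
  let ?D = "SIGMA a:{..s}. core_chains t a \<times> layers a s"
  have fin: "finite (core_chains t a \<times> layers a s)" if "a \<in> {..s}" for a
    using Suc card_layers[of a s] that by simp
  then have "finite ?D" by (rule finite_SigmaI[OF finite_atMost])
  have "real (card (core_chains (Suc t) s)) = real (card ?D)"
    using bij_betw_same_card[OF bij_betw_core_chains_Suc] by metis
  also have "\<dots> = (\<Sum>a\<le>s. real (card (core_chains t a)) * real (card (layers a s)))"
    using fin by (subst card_SigmaI) (auto simp: card_cartesian_product)
  also have "\<dots> = (\<Sum>a\<le>s. fps_nth (layer_fps ^ t) a * fps_nth layer_fps (s - a))"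
    using Suc card_layers by (intro sum.cong) (auto simp: layer_fps_def)
  also have "\<dots> = fps_nth (layer_fps ^ Suc t) s"
    by (simp add: fps_mult_nth atLeast0AtMost power_Suc2 del: power_Suc)
  finally show ?case using \<open>finite ?D\<close> bij_betw_finite[OF bij_betw_core_chains_Suc] by blast
qed

text \<open>The series is \<open>1 / (1 - 2 x)\<close>. In each product the powers of 2 combine to
  \<open>2 ^ n\<close>, leaving a hockey-stick sum of binomials.\<close>

lemma fps_nth_geometric_power:
  "fps_nth (Abs_fps (\<lambda>n. (2::real) ^ n) ^ Suc m) n = 2 ^ n * real ((m + n) choose n)"
proof (induction m arbitrary: n)
  case 0
  then show ?case by simp
next
  case (Suc m)
  let ?G = "Abs_fps (\<lambda>n. (2::real) ^ n)"
  have "fps_nth (?G ^ Suc (Suc m)) n = (\<Sum>i\<le>n. fps_nth (?G ^ Suc m) i * 2 ^ (n - i))"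
    by (subst power_Suc2) (simp add: fps_mult_nth atLeast0AtMost del: power_Suc)
  also have "\<dots> = (\<Sum>i\<le>n. 2 ^ n * real ((m + i) choose i))"
    by (intro sum.cong refl) (simp add: Suc.IH power_add[symmetric] del: power_Suc)
  also have "\<dots> = 2 ^ n * real (\<Sum>i\<le>n. (m + i) choose i)" by (simp add: sum_distrib_left)
  finally show ?case by (simp only: sum_choose_lower add_Suc)
qed

text \<open>The generating function is \<open>(1 - x) / (1 - 2 x) = (1 + 1 / (1 - 2 x)) / 2\<close>.\<close>

lemma fps_nth_layer_fps_power:
  assumes "s \<ge> 1"
  shows "fps_nth (layer_fps ^ t) s = 2 ^ s / 2 ^ t * (\<Sum>m=1..t. real (t choose m) * real ((s + m - 1) choose s))"
proof -
  let ?G = "Abs_fps (\<lambda>n. (2::real) ^ n)"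
  have "layer_fps = fps_const (1/2) * (?G + 1)"
  proof (rule fps_ext)
    fix n show "fps_nth layer_fps n = fps_nth (fps_const (1/2) * (?G + 1)) n"
      by (cases n) (simp_all add: layer_fps_def)
  qed
  then have "layer_fps ^ t = (fps_const (1/2) * (?G + 1)) ^ t" by (rule arg_cong)
  also have "\<dots> = fps_const (1/2) ^ t * (?G + 1) ^ t" by (rule power_mult_distrib)
  also have "\<dots> = fps_const ((1/2) ^ t) * (\<Sum>m\<le>t. of_nat (t choose m) * ?G ^ m)"
    by (simp only: fps_const_power binomial_ring[of ?G 1] power_one mult_1_right)
  finally have "fps_nth (layer_fps ^ t) s = (1/2) ^ t * (\<Sum>m\<le>t. real (t choose m) * fps_nth (?G ^ m) s)"
    by (simp add: fps_sum_nth fps_of_nat[symmetric])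
  \<comment> \<open>The term \<open>m = 0\<close> is the constant series 1, whose coefficient at
    \<open>s >= 1\<close> vanishes.\<close>
  also have "(\<Sum>m\<le>t. real (t choose m) * fps_nth (?G ^ m) s) = (\<Sum>m=1..t. real (t choose m) * fps_nth (?G ^ m) s)"
    using assms by (intro sum.mono_neutral_right) (auto simp: not_less_eq_eq)
  also have "\<dots> = (\<Sum>m=1..t. real (t choose m) * (2 ^ s * real ((s + m - 1) choose s)))"
  proof (intro sum.cong refl)
    fix m assume "m \<in> {1..t}"
    then obtain j where "m = Suc j" by (cases m) auto
    then show "real (t choose m) * fps_nth (?G ^ m) s = real (t choose m) * (2 ^ s * real ((s + m - 1) choose s))"
      using fps_nth_geometric_power[of j s] by (simp add: add.commute)
  qed
  finally show ?thesis by (simp add: sum_distrib_left field_simps)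
qed

subsection \<open>Beta sets and hook lengths\<close>

text \<open>For a partition this is the hook length of the first box of row \<open>i\<close>: arm
  \<open>ps ! i - 1\<close>, leg \<open>length ps - Suc i\<close>, plus 1.\<close>

definition beta :: "nat list \<Rightarrow> nat \<Rightarrow> nat" where
  "beta ps i = ps ! i + (length ps - Suc i)"

definition beta_set :: "nat list \<Rightarrow> nat set" where
  "beta_set ps = beta ps ` {..<length ps}"

lemma beta_set_Nil [simp]: "beta_set [] = {}"
  by (simp add: beta_set_def)

lemma beta_set_Cons [simp]: "beta_set (p # ps) = insert (p + length ps) (beta_set ps)"
  by (simp add: beta_set_def beta_def lessThan_Suc_eq_insert_0 image_image)

lemma finite_beta_set [simp]: "finite (beta_set ps)"
  by (simp add: beta_set_def)

lemma is_partition_Nil [simp]: "is_partition []"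
  by (simp add: is_partition_def)

lemma is_partition_Cons:
  "is_partition (p # ps) \<longleftrightarrow> p \<ge> 1 \<and> (\<forall>q\<in>set ps. q \<le> p) \<and> is_partition ps"
  by (auto simp: is_partition_def)

lemma beta_set_less:
  assumes "\<And>q. q \<in> set ps \<Longrightarrow> q \<le> p" "x \<in> beta_set ps"
  shows "x < p + length ps"
  using assms
proof (induction ps)
  case (Cons q ps)
  then show ?case by fastforce
qed simp

lemma zero_notin_beta_set: "is_partition ps \<Longrightarrow> 0 \<notin> beta_set ps"
  by (induction ps) (auto simp: is_partition_Cons)

lemma card_beta_set: "is_partition ps \<Longrightarrow> card (beta_set ps) = length ps"
proof (induction ps)
  case (Cons p ps)
  then have "p + length ps \<notin> beta_set ps"
    using beta_set_less[of ps p "p + length ps"] by (auto simp: is_partition_Cons)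
  then show ?case using Cons by (simp add: is_partition_Cons)
qed simp

text \<open>Cardinality gives the length, and the greatest element then gives the first part; remove
  it and induct.\<close>

lemma beta_set_inj:
  "is_partition ps \<Longrightarrow> is_partition qs \<Longrightarrow> beta_set ps = beta_set qs \<Longrightarrow> ps = qs"
proof (induction ps arbitrary: qs)
  case Nil
  then show ?case using card_beta_set[of qs] by simp
next
  case (Cons p ps)
  have "length qs = Suc (length ps)"
    using card_beta_set[OF Cons.prems(1)] card_beta_set[OF Cons.prems(2)] Cons.prems(3) by simp
  then obtain q qs' where qs: "qs = q # qs'" and len: "length qs' = length ps"
    by (cases qs) auto
  have P: "is_partition ps" "\<And>x. x \<in> beta_set ps \<Longrightarrow> x < p + length ps"
    using Cons.prems(1) beta_set_less[of ps p] by (auto simp: is_partition_Cons)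
  have Q: "is_partition qs'" "\<And>x. x \<in> beta_set qs' \<Longrightarrow> x < q + length ps"
    using Cons.prems(2) beta_set_less[of qs' q] len by (auto simp: is_partition_Cons qs)
  have eq: "insert (p + length ps) (beta_set ps) = insert (q + length ps) (beta_set qs')"
    using Cons.prems(3) len qs by simp
  then have "p + length ps \<le> q + length ps" "q + length ps \<le> p + length ps"
    using P(2) Q(2) by (metis insert_iff less_imp_le order_refl)+
  then have "p = q" by simp
  moreover have "beta_set ps = beta_set qs'"
    using eq P(2) Q(2) \<open>p = q\<close> by (metis insert_ident nat_neq_iff)
  ultimately show ?case using Cons.IH[OF P(1) Q(1)] qs by simp
qed

text \<open>Insert the elements in increasing order; a new greatest element \<open>b\<close>
  prepends the part \<open>b - length ps\<close>.\<close>

lemma beta_set_surj: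
  "finite X \<Longrightarrow> 0 \<notin> X \<Longrightarrow> \<exists>ps. is_partition ps \<and> beta_set ps = X"
proof (induction X rule: finite_linorder_max_induct)
  case empty
  show ?case by (intro exI[of _ "[]"]) simp
next
  case (insert b X)
  then obtain ps where ps: "is_partition ps" "beta_set ps = X" by auto
  \<comment> \<open>Exactly what makes the new part positive and at least as large as the
    others.\<close>
  have "length ps < b \<and> (\<forall>q\<in>set ps. q + length ps \<le> b)"
  proof (cases ps)
    case Nil
    then show ?thesis using insert.prems by simp
  next
    case (Cons p qs)
    then have "p + length qs < b" using insert.hyps ps by auto
    then show ?thesis using ps Cons by (auto simp: is_partition_Cons)
  qed
  then have "is_partition ((b - length ps) # ps)" "beta_set ((b - length ps) # ps) = insert b X"
    using ps by (auto simp: is_partition_Cons)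
  then show ?case by blast
qed

lemma is_partition_antimono: "is_partition ps \<Longrightarrow> i \<le> j \<Longrightarrow> j < length ps \<Longrightarrow> ps ! j \<le> ps ! i"
  unfolding is_partition_def sorted_wrt_iff_nth_less by (cases "i = j") auto

lemma card_initial_segment:
  assumes "\<And>i. i \<in> A \<longleftrightarrow> i < (r::nat)"
  shows "card {i'. i < i' \<and> i' \<in> A} = r - Suc i"
proof -
  have "{i'. i < i' \<and> i' \<in> A} = {i<..<r}" by (simp add: assms set_eq_iff)
  then show ?thesis by simp
qed

text \<open>The box in row \<open>i\<close> and column \<open>j\<close> of a partition with \<open>n\<close> rows, whose column \<open>j\<close> has
  length \<open>r\<close>, corresponds to the gap \<open>j + n - r\<close> of the beta set.\<close>

lemma beta_minus_hook_length:
  assumes "\<And>i'. i' < length ps \<and> j < ps ! i' \<longleftrightarrow> i' < r" "i < length ps" "j < ps ! i"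
  shows "beta ps i = hook_length ps i j + (j + (length ps - r))"
proof -
  have "{j'. j < j' \<and> (i, j') \<in> young_diagram ps} = {j<..<ps ! i}"
    using assms(2) by (auto simp: young_diagram_def)
  moreover have "card {i'. i < i' \<and> (i', j) \<in> young_diagram ps} = r - Suc i"
    using card_initial_segment[of "{i'. (i', j) \<in> young_diagram ps}" r i] assms(1)
    by (simp add: young_diagram_def)
  moreover have "i < r" using assms by blast
  moreover have "r \<le> length ps" using assms(1)[of "r - 1"] \<open>i < r\<close> by auto
  ultimately show ?thesis using assms(2,3) by (simp add: hook_length_def beta_def)
qed

text \<open>The \<open>r\<close> rows meeting column \<open>j\<close> have larger beta numbers, all
  later rows smaller ones.\<close>

lemma column_gap:
  assumes "\<And>i'. i' < length ps \<and> j < ps ! i' \<longleftrightarrow> i' < r" "r \<le> length ps"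
  shows "j + (length ps - r) \<notin> beta_set ps"
proof
  assume "j + (length ps - r) \<in> beta_set ps"
  then obtain i where i: "i < length ps" "j + (length ps - r) = ps ! i + (length ps - Suc i)"
    by (auto simp: beta_set_def beta_def)
  then show False using assms(1)[of i] assms(2) by (cases "i < r") auto
qed

lemma ex_threshold:
  fixes n :: nat
  assumes "\<And>i j. i \<le> j \<Longrightarrow> j < n \<Longrightarrow> P j \<Longrightarrow> P i"
  shows "\<exists>r\<le>n. \<forall>i. i < n \<and> P i \<longleftrightarrow> i < r"
proof -
  define r where "r = (LEAST i. \<not> (i < n \<and> P i))"
  have "\<not> (r < n \<and> P r)" unfolding r_def by (rule LeastI[of _ n]) simp
  moreover have "r \<le> n" unfolding r_def by (rule Least_le) simp
  moreover have "i < n \<and> P i" if "i < r" for i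
    using not_less_Least[of i "\<lambda>i. \<not> (i < n \<and> P i)"] that unfolding r_def by simp
  moreover have "i < r" if "i < n" "P i" for i
  proof (rule ccontr)
    assume "\<not> i < r"
    then have "r < n \<and> P r" using assms[of r i] that by simp
    then show False using \<open>\<not> (r < n \<and> P r)\<close> by simp
  qed
  ultimately show ?thesis by blast
qed

lemma hook_length_gap:
  assumes "is_partition ps" "i < length ps" "j < ps ! i"
  shows "\<exists>y. y \<notin> beta_set ps \<and> beta ps i = hook_length ps i j + y"
proof -
  obtain r where "r \<le> length ps" "\<And>i'. i' < length ps \<and> j < ps ! i' \<longleftrightarrow> i' < r"
    using ex_threshold[of "length ps" "\<lambda>i'. j < ps ! i'"] is_partition_antimono[OF assms(1)]
    by (meson less_le_trans)
  then show ?thesis using column_gap[of ps j r] beta_minus_hook_length[of ps j r i] assms by blast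
qed

text \<open>Converse of \<open>hook_length_gap\<close>: the hook lengths in row \<open>i\<close> are
  precisely the distances from its beta number down to smaller gaps.\<close>

lemma gap_hook_length:
  assumes "is_partition ps" "i < length ps" "y \<notin> beta_set ps" "y < beta ps i"
  shows "\<exists>j<ps ! i. beta ps i = hook_length ps i j + y"
proof -
  let ?n = "length ps"
  have anti: "ps ! l \<le> ps ! k" if "k \<le> l" "l < ?n" for k l
    using is_partition_antimono[OF assms(1) that] .
  have beta_anti: "beta ps l \<le> beta ps k" if "k \<le> l" "l < ?n" for k l
    using anti[OF that] that by (simp add: beta_def)
  have "\<exists>r\<le>?n. \<forall>k. k < ?n \<and> y < beta ps k \<longleftrightarrow> k < r"
    using beta_anti by (intro ex_threshold) (meson less_le_trans)
  then obtain r where le: "r \<le> ?n" and r: "\<And>k. k < ?n \<and> y < beta ps k \<longleftrightarrow> k < r" by blast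
  have less: "k < ?n \<and> y < beta ps k" if "k < r" for k using r that by blast
  have P: "\<not> (r < ?n \<and> y < beta ps r)" using r by blast
  have "i < r" using r assms(2,4) by blast
  have large: "?n - r \<le> y"
  proof (cases "r < ?n")
    case True
    then have "beta ps r \<in> beta_set ps" by (simp add: beta_set_def)
    then have "beta ps r < y" using P True assms(3) by (metis nat_neq_iff)
    then show ?thesis by (simp add: beta_def)
  qed simp
  \<comment> \<open>Exactly \<open>r\<close> beta numbers exceed \<open>y\<close> and
    \<open>?n - r\<close> lie below it, so \<open>?j\<close> is the number of gaps below
    \<open>y\<close>. The column with this index turns out to have length \<open>r\<close>.\<close>
  let ?j = "y - (?n - r)"
  have col: "k < ?n \<and> ?j < ps ! k \<longleftrightarrow> k < r" for k
  proof
    assume "k < r"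
    then have "k \<le> r - 1" "r - 1 < r" "r - 1 < ?n" using le by auto
    then have "ps ! (r - 1) \<le> ps ! k" "y < beta ps (r - 1)" using anti less by blast+
    then have "y < ps ! k + (?n - r)" using \<open>r - 1 < ?n\<close> \<open>k < r\<close> by (simp add: beta_def)
    then show "k < ?n \<and> ?j < ps ! k" using large le \<open>k < r\<close> by linarith
  next
    assume k: "k < ?n \<and> ?j < ps ! k"
    show "k < r"
    proof (rule ccontr)
      assume "\<not> k < r"
      then have rk: "r \<le> k" "r < ?n" using k by auto
      then have "beta ps r \<in> beta_set ps" by (simp add: beta_set_def)
      then have "beta ps r < y" using P rk assms(3) by (metis nat_neq_iff)
      then have "ps ! r + (?n - Suc r) < y" by (simp add: beta_def)
      moreover have "ps ! k \<le> ps ! r" using anti rk k by simp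
      ultimately show False using k rk by linarith
    qed
  qed
  then have "?j < ps ! i" using \<open>i < r\<close> by blast
  moreover have "?j + (?n - r) = y" using large by simp
  ultimately show ?thesis using beta_minus_hook_length[OF col assms(2)] by metis
qed

section \<open>Maya diagrams of cores\<close>

definition maya :: "nat list \<Rightarrow> int set" where
  "maya ps = {..<0} \<union> int ` beta_set ps"

lemma maya_iff: "x \<in> maya ps \<longleftrightarrow> x < 0 \<or> nat x \<in> beta_set ps"
  by (cases "x < 0") (auto simp: maya_def image_iff intro!: bexI[of _ "nat x"])

lemma maya_of_nat [simp]: "int n \<in> maya ps \<longleftrightarrow> n \<in> beta_set ps"
  by (simp add: maya_iff)

text \<open>A forbidden hook is a bead \<open>x\<close> with a gap at \<open>x - s - k t\<close>.
  Since all negative integers are beads, only nonnegative differences matter.\<close>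

lemma is_core_iff_down_closed:
  assumes "is_partition ps"
  shows "is_core {s + k * t | k. True} ps \<longleftrightarrow> down_closed s t (maya ps)"
proof
  assume core: "is_core {s + k * t | k. True} ps"
  show "down_closed s t (maya ps)"
    unfolding down_closed_def
  proof (intro ballI allI)
    fix x k assume x: "x \<in> maya ps"
    show "x - int s - int k * int t \<in> maya ps"
    proof (cases "x < int s + int k * int t")
      case False
      then have nonneg: "x - int s - int k * int t \<ge> 0" by simp
      then obtain y where y: "x - int s - int k * int t = int y" using nonneg_int_cases by blast
      then have xy: "x = int (s + k * t + y)" by (simp add: algebra_simps)
      then have "s + k * t + y \<in> beta_set ps" using x maya_of_nat by metis
      then obtain i where i: "i < length ps" "beta ps i = s + k * t + y"
        by (auto simp: beta_set_def)
      have "y \<in> beta_set ps"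
      proof (rule ccontr)
        assume ny: "y \<notin> beta_set ps"
        \<comment> \<open>If \<open>s + k t = 0\<close>, then \<open>y\<close> would itself be a
          beta number.\<close>
        then have "y < beta ps i" using i by (cases "s + k * t = 0") (auto simp: beta_set_def)
        then obtain j where j: "j < ps ! i" "beta ps i = hook_length ps i j + y"
          using gap_hook_length[OF assms i(1) ny] by blast
        then have "hook_length ps i j = s + k * t" using i by simp
        moreover have "(i, j) \<in> young_diagram ps" using i j by (simp add: young_diagram_def)
        ultimately show False using core by (auto simp: is_core_def)
      qed
      then show ?thesis using y by simp
    qed (simp add: maya_iff)
  qed
next
  assume dc: "down_closed s t (maya ps)"
  have "hook_length ps i j \<noteq> s + k * t" if ij: "(i, j) \<in> young_diagram ps" for i j k
  proof
    assume h: "hook_length ps i j = s + k * t"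
    have i: "i < length ps" "j < ps ! i" using ij by (auto simp: young_diagram_def)
    then obtain y where y: "y \<notin> beta_set ps" "beta ps i = s + k * t + y"
      using hook_length_gap[OF assms i] h by auto
    have "int (beta ps i) \<in> maya ps" using i by (simp add: beta_set_def)
    from down_closedD[OF dc this, of k] have "int y \<in> maya ps" using y(2) by simp
    then show False using y(1) by simp
  qed
  then show "is_core {s + k * t | k. True} ps" using assms by (auto simp: is_core_def)
qed

text \<open>Positive parts make 0 the least gap. Conversely, the bound \<open>t s\<close> leaves
  finitely many nonnegative elements, which form the beta set of a partition.\<close>

lemma bij_betw_ap_cores_gap_normal:
  assumes "coprime s t" "t \<ge> 1"
  shows "bij_betw maya (ap_cores s t) (gap_normal s t)"
proof (rule bij_betw_imageI)
  show "inj_on maya (ap_cores s t)"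
  proof (rule inj_onI)
    fix ps qs assume "ps \<in> ap_cores s t" "qs \<in> ap_cores s t" "maya ps = maya qs"
    moreover from this have "beta_set ps = beta_set qs" by (metis maya_of_nat set_eqI)
    ultimately show "ps = qs" by (auto simp: ap_cores_def is_core_def intro: beta_set_inj)
  qed
  show "maya ` ap_cores s t = gap_normal s t"
  proof (intro equalityI subsetI)
    fix B assume "B \<in> maya ` ap_cores s t"
    then obtain ps where B: "B = maya ps" and ps: "is_core {s + k * t | k. True} ps"
      by (auto simp: ap_cores_def)
    then have part: "is_partition ps" by (simp add: is_core_def)
    then have "0 \<notin> maya ps" using zero_notin_beta_set by (simp add: maya_iff)
    then show "B \<in> gap_normal s t"
      using is_core_iff_down_closed[OF part] ps by (auto simp: B gap_normal_def maya_def)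
  next
    fix B assume B: "B \<in> gap_normal s t"
    let ?X = "{n. int n \<in> B}"
    have "?X \<subseteq> {..<t * s}"
    proof
      fix n assume "n \<in> ?X"
      then have "int n < int t * int s" using gap_normal_less[OF assms B] by simp
      then show "n \<in> {..<t * s}" by (metis lessThan_iff of_nat_less_iff of_nat_mult)
    qed
    then have "finite ?X" by (rule finite_subset) simp
    moreover have "0 \<notin> ?X" using B by (simp add: gap_normal_def)
    ultimately obtain ps where ps: "is_partition ps" "beta_set ps = ?X" using beta_set_surj by blast
    have "maya ps = B"
    proof (rule set_eqI)
      fix x show "x \<in> maya ps \<longleftrightarrow> x \<in> B"
        using B ps by (cases "x < 0") (auto simp: maya_iff gap_normal_def)
    qed
    moreover have "ps \<in> ap_cores s t"
      using is_core_iff_down_closed[OF ps(1)] B \<open>maya ps = B\<close> by (simp add: ap_cores_def gap_normal_def)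
    ultimately show "B \<in> maya ` ap_cores s t" by blast
  qed
qed

text \<open>The factor \<open>t\<close> comes from the choice of the residue class that is
  normalised.\<close>

lemma card_ap_cores:
  assumes "coprime s t" "t \<ge> 1" "s \<ge> 1"
  shows "finite (ap_cores s t) \<and>
    real t * real (card (ap_cores s t)) =
      2 ^ s / 2 ^ t * (\<Sum>m=1..t. real (t choose m) * real ((s + m - 1) choose s))"
proof -
  obtain f where f: "bij_betw f ({0..<int t} \<times> gap_normal s t) (top_normal s t)"
    using bij_betw_gap_normal_top_normal[OF assms(1,2)] by blast
  obtain g where g: "bij_betw g (top_normal s t) (core_chains t s)"
    using bij_betw_top_normal_core_chains[OF assms(1,2)] by blast
  have h: "bij_betw maya (ap_cores s t) (gap_normal s t)"
    by (rule bij_betw_ap_cores_gap_normal[OF assms(1,2)])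
  have "finite ({0..<int t} \<times> gap_normal s t)"
    using card_core_chains bij_betw_finite[OF f] bij_betw_finite[OF g] by blast
  then have "finite (gap_normal s t)" using assms(2) by (auto simp: finite_cartesian_product_iff)
  then have "finite (ap_cores s t)" using bij_betw_finite[OF h] by blast
  moreover have "t * card (ap_cores s t) = card (core_chains t s)"
    using bij_betw_same_card[OF f] bij_betw_same_card[OF g] bij_betw_same_card[OF h]
    by (simp add: card_cartesian_product)
  then have "real t * real (card (ap_cores s t)) = real (card (core_chains t s))"
    by (metis of_nat_mult)
  ultimately show ?thesis using card_core_chains fps_nth_layer_fps_power[OF assms(3)] by metis
qed

subsection \<open>The polynomial\<close>

lemma degree_lead_coeff_pochhammer:
  fixes c :: "'a::idom"
  shows "degree (pochhammer [:c, 1:] n) = n \<and> lead_coeff (pochhammer [:c, 1:] n) = 1"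
proof (induction n)
  case (Suc n)
  have eq: "[:c, 1:] + of_nat n = [:c + of_nat n, 1:]" by (simp add: of_nat_poly)
  have "pochhammer [:c, 1:] n \<noteq> 0" using Suc by force
  then have "degree (pochhammer [:c, 1:] (Suc n)) = Suc n"
    using Suc by (simp add: pochhammer_Suc eq degree_mult_eq del: mult_pCons_right)
  moreover have "lead_coeff (pochhammer [:c, 1:] (Suc n)) = 1"
    unfolding pochhammer_Suc eq lead_coeff_mult conjunct2[OF Suc] by simp
  ultimately show ?case by simp
qed simp

lemma poly_pochhammer: "poly (pochhammer p n) x = pochhammer (poly p x) n"
  by (simp add: pochhammer_prod poly_prod)

lemma coeff_pochhammer_nonneg:
  fixes c :: "'a::linordered_idom"
  assumes "c \<ge> 0"
  shows "coeff (pochhammer [:c, 1:] n) i \<ge> 0"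
proof (induction n arbitrary: i)
  case 0
  then show ?case by (cases i) auto
next
  case (Suc n)
  have "[:c, 1:] + of_nat n = [:c + of_nat n, 1:]" by (simp add: of_nat_poly)
  then show ?case using Suc assms
    by (simp add: pochhammer_Suc coeff_pCons split: nat.split)
qed

text \<open>For \<open>m <= t\<close> the division is exact, which is why the coefficients are
  integers.\<close>

definition int_lah :: "nat \<Rightarrow> nat \<Rightarrow> int" where
  "int_lah t m = int (fact t div fact m * ((t - 1) choose (m - 1)))"

lemma of_int_int_lah: "m \<le> t \<Longrightarrow> real_of_int (int_lah t m) = lah t m"
  by (simp add: int_lah_def lah_def real_of_nat_div fact_dvd)

lemma int_lah_refl: "t \<ge> 1 \<Longrightarrow> int_lah t t = 1"
  by (simp add: int_lah_def)

definition core_poly :: "nat \<Rightarrow> int poly" where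
  "core_poly t = (\<Sum>m=1..t. smult (int_lah t m) (pochhammer [:1, 1:] (m - 1)))"

lemma map_poly_of_int_add:
  "map_poly (of_int :: int \<Rightarrow> real) (p + q) = map_poly of_int p + map_poly of_int q"
  by (intro poly_eqI) (simp add: coeff_map_poly)

lemma map_poly_of_int_mult:
  "map_poly (of_int :: int \<Rightarrow> real) (p * q) = map_poly of_int p * map_poly of_int q"
  by (intro poly_eqI) (simp add: coeff_map_poly coeff_mult)

lemma map_poly_of_int_sum:
  "map_poly (of_int :: int \<Rightarrow> real) (sum f A) = (\<Sum>x\<in>A. map_poly of_int (f x))"
  by (induction A rule: infinite_finite_induct) (simp_all add: map_poly_of_int_add)

lemma map_poly_of_int_pochhammer:
  "map_poly (of_int :: int \<Rightarrow> real) (pochhammer p n) = pochhammer (map_poly of_int p) n"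
proof (induction n)
  case (Suc n)
  have "map_poly (of_int :: int \<Rightarrow> real) (of_nat n) = of_nat n"
    by (simp add: of_nat_poly map_poly_pCons)
  then show ?case using Suc by (simp add: pochhammer_Suc map_poly_of_int_mult map_poly_of_int_add)
qed simp

lemma poly_core_poly: "poly (map_poly of_int (core_poly t)) x = core_fun t x"
  by (simp add: core_poly_def core_fun_def map_poly_of_int_sum map_poly_smult map_poly_of_int_pochhammer
      map_poly_pCons poly_sum poly_pochhammer of_int_int_lah add.commute)

lemma coeff_core_poly_nonneg: "coeff (core_poly t) i \<ge> 0"
  by (simp add: core_poly_def coeff_sum sum_nonneg coeff_pochhammer_nonneg int_lah_def)

text \<open>Summand \<open>m\<close> has degree \<open>m - 1\<close>, so only \<open>m = t\<close>
  reaches degree \<open>t - 1\<close>, with factor \<open>L(t,t) = 1\<close>.\<close>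

lemma degree_core_poly:
  assumes "t \<ge> 1"
  shows "degree (core_poly t) = t - 1 \<and> lead_coeff (core_poly t) = 1"
proof -
  let ?f = "\<lambda>m. smult (int_lah t m) (pochhammer [:1, 1:] (m - 1))"
  note poch = degree_lead_coeff_pochhammer[of "1::int"]
  have coeff: "coeff (?f m) i = (if m = t \<and> i = t - 1 then 1 else 0)"
    if "m \<in> {1..t}" "i \<ge> t - 1" for m i
  proof (cases "m - 1 = i")
    case True
    then have "m = t" using that assms by auto
    then show ?thesis using True poch[of "t - 1"] int_lah_refl[OF assms] by auto
  next
    case False
    then have "degree (pochhammer [:1, 1::int:] (m - 1)) < i" using that poch[of "m - 1"] by auto
    then show ?thesis using False by (auto simp: coeff_eq_0)
  qed
  have "coeff (core_poly t) i = (if i = t - 1 then 1 else 0)" if "i \<ge> t - 1" for i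
  proof -
    have "coeff (core_poly t) i = (\<Sum>m=1..t. if m = t \<and> i = t - 1 then 1 else 0)"
      unfolding core_poly_def coeff_sum using coeff that by (intro sum.cong) auto
    also have "\<dots> = (if i = t - 1 then 1 else 0)" using assms by (cases "i = t - 1") auto
    finally show ?thesis .
  qed
  then have "degree (core_poly t) \<le> t - 1" "coeff (core_poly t) (t - 1) = 1"
    by (auto intro!: degree_le)
  then show ?thesis by (metis le_antisym le_degree zero_neq_one)
qed

section \<open>Lah numbers and binomial coefficients\<close>

lemma fact_mult_binomial_absorb:
  assumes "1 \<le> m" "m \<le> t"
  shows "real t * real ((t - 1) choose (m - 1)) = real m * real (t choose m)"
proof -
  obtain j k where "t = Suc j" "m = Suc k" using assms by (cases t; cases m) auto
  then show ?thesis using Suc_times_binomial_eq[of j k] by (metis diff_Suc_1 mult.commute of_nat_mult)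
qed

text \<open>This turns Lah numbers into the binomials of the generating function; it yields both the
  constant term and the count.\<close>

lemma lah_div_fact:
  assumes "1 \<le> m" "m \<le> t"
  shows "real t * lah t m / fact t * fact (m - 1) = real (t choose m)"
proof -
  have "fact m = real m * fact (m - 1)" using assms by (simp add: fact_reduce)
  then show ?thesis using fact_mult_binomial_absorb[OF assms] assms
    by (simp add: lah_def field_simps)
qed

text \<open>At 0 the rising factorial is \<open>(m - 1)!\<close>, so each summand is
  \<open>(t choose m) * (t - 1)!\<close>, and the row sum without \<open>m = 0\<close> is
  \<open>2 ^ t - 1\<close>.\<close>

lemma coeff_core_poly_0:
  assumes "t \<ge> 1"
  shows "coeff (core_poly t) 0 = (2 ^ t - 1) * fact (t - 1)"
proof -
  have tf: "fact t = real t * fact (t - 1)" using assms by (simp add: fact_reduce)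
  have "real_of_int (coeff (core_poly t) 0) = core_fun t 0"
    using poly_core_poly[of t 0] by (simp add: poly_0_coeff_0 coeff_map_poly)
  also have "\<dots> = (\<Sum>m=1..t. real (t choose m) * fact (t - 1))"
    unfolding core_fun_def
  proof (intro sum.cong refl)
    fix m assume "m \<in> {1..t}"
    then have "real t * lah t m / fact t * fact (m - 1) = real (t choose m)"
      using lah_div_fact by simp
    then show "lah t m * pochhammer (0 + 1) (m - 1) = real (t choose m) * fact (t - 1)"
      using tf assms by (simp add: pochhammer_fact[symmetric] field_simps)
  qed
  also have "\<dots> = real (\<Sum>m=1..t. t choose m) * fact (t - 1)"
    by (simp add: sum_distrib_right)
  also have "(\<Sum>m=1..t. t choose m) = 2 ^ t - 1"
  proof -
    have "{..t} = insert 0 {1..t}" by auto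
    then show ?thesis using choose_row_sum[of t] by simp
  qed
  finally have "real_of_int (coeff (core_poly t) 0) = real_of_int ((2 ^ t - 1) * fact (t - 1))"
    by (simp add: of_nat_diff)
  then show ?thesis by (simp only: of_int_eq_iff)
qed

lemma core_fun_eq_binomial_sum:
  shows "real t * core_fun t (real s) / fact t = (\<Sum>m=1..t. real (t choose m) * real ((s + m - 1) choose s))"
  unfolding core_fun_def sum_distrib_left sum_divide_distrib
proof (intro sum.cong refl)
  fix m assume m: "m \<in> {1..t}"
  then obtain k where k: "m = Suc k" by (cases m) auto
  \<comment> \<open>Dividing the rising factorial by the \<open>k!\<close> that
    \<open>lah_div_fact\<close> supplies gives the binomial of the generating function.\<close>
  have "real ((s + k) choose s) = pochhammer (real s + 1) k / fact k"
    by (simp add: binomial_gbinomial gbinomial_pochhammer' binomial_symmetric[of s "s + k"])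
  moreover have "real t * lah t m / fact t * fact k = real (t choose m)"
    using lah_div_fact[of m t] m k by simp
  ultimately show "real t * (lah t m * pochhammer (real s + 1) (m - 1)) / fact t =
      real (t choose m) * real ((s + m - 1) choose s)"
    by (simp add: k field_simps) (metis mult.assoc mult.commute)
qed

theorem theorem1p8:
  fixes t :: nat
  assumes "t \<ge> 1"
  shows "(\<exists>p :: int poly.
            (\<forall>x::real. core_fun t x = poly (map_poly of_int p) x) \<and>
            lead_coeff p = 1 \<and> degree p = t - 1 \<and>
            (\<forall>i. coeff p i \<ge> 0) \<and>
            coeff p 0 = (2 ^ t - 1) * fact (t - 1)) \<and>
         (\<forall>s::nat. s \<ge> 1 \<longrightarrow> coprime s t \<longrightarrow>
            finite (ap_cores s t) \<and>
            real (card (ap_cores s t)) = 2 powi (int s - int t) * core_fun t (real s) / fact t)"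
proof (intro conjI allI impI)
  show "\<exists>p :: int poly.
            (\<forall>x::real. core_fun t x = poly (map_poly of_int p) x) \<and>
            lead_coeff p = 1 \<and> degree p = t - 1 \<and>
            (\<forall>i. coeff p i \<ge> 0) \<and>
            coeff p 0 = (2 ^ t - 1) * fact (t - 1)"
    using poly_core_poly degree_core_poly[OF assms] coeff_core_poly_nonneg coeff_core_poly_0[OF assms]
    by metis
next
  fix s :: nat
  assume s: "s \<ge> 1" "coprime s t"
  show "finite (ap_cores s t)" using card_ap_cores[OF s(2) assms s(1)] by blast
  have "real t * real (card (ap_cores s t)) = 2 ^ s / 2 ^ t * (real t * core_fun t (real s) / fact t)"
    using card_ap_cores[OF s(2) assms s(1)] core_fun_eq_binomial_sum by simp
  also have "\<dots> = real t * (2 powi (int s - int t) * core_fun t (real s) / fact t)"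
    by (simp add: power_int_diff)
  finally show "real (card (ap_cores s t)) = 2 powi (int s - int t) * core_fun t (real s) / fact t"
    using assms by (subst (asm) mult_cancel_left) simp
qed

end
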